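(* Let $k\geq 3$ be an integer. Let $G$ be a connected non-complete bipartite graph of order $n$ such that any two distinct vertices in the same vertex class have at least $2\left(\log_{\frac{k^{2}}{3k-2}} k\right)\left(\log_{k} n\right)$ common neighbors in the other class. Then $rc(G)\leq k$.
   Context: All graphs are finite, undirected and simple; the order of a graph is its number of vertices; $\log_b$ denotes the logarithm to base $b$. The vertex classes of a bipartite graph are the two parts of its bipartition, and a non-complete bipartite graph is a bipartite graph that is not complete bipartite, i.e. some two vertices from different classes are non-adjacent. An edge-coloring of $G$ is a function from its edge set to the natural numbers (adjacent edges may receive the same color). An edge-colored graph is rainbow connected if every two distinct vertices are joined by a path whose edges have pairwise distinct colors. The rainbow connection number $rc(G)$ of a connected graph $G$ is the smallest number of colors needed in an edge-coloring that makes $G$ rainbow connected. Thus $rc(G)\leq k$ means that there is an edge-coloring of $G$ with at most $k$ colors making $G$ rainbow connected. *)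

theory Defs
  imports Complex_Main "Graph_Theory.Graph_Theory"
begin

text \<open>
  A finite simple graph is a \<^locale>\<open>pair_graph\<close>, which represents the undirected edge
  \<open>{u, v}\<close> by the two arcs \<open>(u, v)\<close> and \<open>(v, u)\<close>. Colorings are functions on the
  undirected edges, so both arcs of an edge automatically have the same color.
\<close>

definition edges :: "'a pair_pre_digraph \<Rightarrow> 'a set set" where
  "edges G = {{u, v} | u v. (u, v) \<in> parcs G}"

definition neighbors :: "'a pair_pre_digraph \<Rightarrow> 'a \<Rightarrow> 'a set" where
  "neighbors G u = {v \<in> pverts G. (u, v) \<in> parcs G}"

definition bipartition :: "'a pair_pre_digraph \<Rightarrow> 'a set \<Rightarrow> 'a set \<Rightarrow> bool" where
  "bipartition G A B \<longleftrightarrow> A \<union> B = pverts G \<and> A \<inter> B = {} \<and>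
     (\<forall>(u, v) \<in> parcs G. u \<in> A \<and> v \<in> B \<or> u \<in> B \<and> v \<in> A)"

definition complete_between :: "'a pair_pre_digraph \<Rightarrow> 'a set \<Rightarrow> 'a set \<Rightarrow> bool" where
  "complete_between G A B \<longleftrightarrow> (\<forall>u \<in> A. \<forall>v \<in> B. (u, v) \<in> parcs G)"

text \<open>
  Paths are given by their vertex lists; \<^const>\<open>vpath\<close> already requires the vertices to be
  distinct and consecutive ones to be adjacent.
\<close>

definition rainbow :: "('a set \<Rightarrow> nat) \<Rightarrow> 'a list \<Rightarrow> bool" where
  "rainbow c p \<longleftrightarrow> distinct (map (\<lambda>(u, v). c {u, v}) (vwalk_arcs p))"

definition rainbow_connected :: "'a pair_pre_digraph \<Rightarrow> ('a set \<Rightarrow> nat) \<Rightarrow> bool" where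
  "rainbow_connected G c \<longleftrightarrow>
     (\<forall>u \<in> pverts G. \<forall>v \<in> pverts G. u \<noteq> v \<longrightarrow>
        (\<exists>p. vpath p (with_proj G) \<and> hd p = u \<and> last p = v \<and> rainbow c p))"

text \<open>
  The values of \<open>c\<close> outside \<^term>\<open>edges G\<close> are irrelevant: only colors occurring on
  edges are counted. For a disconnected \<open>G\<close> the value is unspecified.
\<close>

definition rc :: "'a pair_pre_digraph \<Rightarrow> nat" where
  "rc G = (LEAST m. \<exists>c. rainbow_connected G c \<and> card (c ` edges G) = m)"

lemma finite_edges:
  assumes "pair_graph G" shows "finite (edges G)"
proof -
  have "edges G = (\<lambda>(u, v). {u, v}) ` parcs G" by (auto simp: edges_def image_def)
  moreover have "finite (parcs G)"
    using assms by (simp add: pair_graph_def pair_digraph_def pair_fin_digraph.pair_finite_arcs)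
  ultimately show ?thesis by simp
qed

lemma vwalk_arcs_in_set:
  "(u, v) \<in> set (vwalk_arcs p) \<Longrightarrow> u \<in> set p \<and> v \<in> set p"
  by (induction p rule: vwalk_arcs.induct) auto

lemma distinct_undirected_arcs:
  "distinct p \<Longrightarrow> distinct (map (\<lambda>(u, v). {u, v}) (vwalk_arcs p))"
proof (induction p rule: vwalk_arcs.induct)
  case (3 x y xs)
  have "{x, y} \<noteq> {u, v}" if "(u, v) \<in> set (vwalk_arcs (y # xs))" for u v
  proof
    assume "{x, y} = {u, v}"
    then have "x = u \<or> x = v" by blast
    with vwalk_arcs_in_set[OF that] have "x \<in> set (y # xs)" by blast
    with 3 show False by simp
  qed
  then have "{x, y} \<notin> set (map (\<lambda>(u, v). {u, v}) (vwalk_arcs (y # xs)))"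
    by (simp add: image_iff split_beta)
  with 3 show ?case by simp
qed simp_all

lemma exists_rainbow_connected:
  assumes G: "pair_graph G" and conn: "Digraph_Component.connected (with_proj G)"
  shows "\<exists>c. rainbow_connected G c"
proof -
  interpret pair_graph G by (rule G)
  obtain c :: "'a set \<Rightarrow> nat" where c: "inj_on c (edges G)"
    using finite_imp_inj_to_nat_seg[OF finite_edges[OF G]] by blast
  have sym: "parcs (mk_symmetric (with_proj G)) = parcs G"
    using pair_sym_arcs unfolding mk_symmetric_def symmetric_def sym_def by fastforce
  have mk: "mk_symmetric (with_proj G) = G"
    using sym by (intro pair_pre_digraph.equality) (auto simp: mk_symmetric_def)
  have "\<exists>p. vpath p (with_proj G) \<and> hd p = u \<and> last p = v \<and> rainbow c p"
    if "u \<in> pverts G" "v \<in> pverts G" for u v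
  proof -
    have "reachable (with_proj G) u v"
      using conn that unfolding Digraph_Component.connected_def mk strongly_connected_def by simp
    then obtain p where p: "vpath p (with_proj G)" "hd p = u" "last p = v"
      using reachable_vpath_conv by auto
    let ?es = "map (\<lambda>(u, v). {u, v}) (vwalk_arcs p)"
    have "distinct ?es" using p(1) distinct_undirected_arcs by (auto simp: vpath_def)
    moreover have "set ?es \<subseteq> edges G"
      using p(1) by (auto simp: vpath_def vwalk_def edges_def)
    ultimately have "distinct (map c ?es)"
      using c unfolding distinct_map[of c] by (blast intro: inj_on_subset)
    then have "rainbow c p" by (simp add: rainbow_def comp_def case_prod_unfold)
    with p show ?thesis by blast
  qed
  then show ?thesis unfolding rainbow_connected_def by blast
qed

lemma rc_le_iff:
  assumes "pair_graph G" and "Digraph_Component.connected (with_proj G)"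
  shows "rc G \<le> k \<longleftrightarrow> (\<exists>c. rainbow_connected G c \<and> card (c ` edges G) \<le> k)"
proof
  assume "rc G \<le> k"
  moreover have "\<exists>c. rainbow_connected G c \<and> card (c ` edges G) = rc G"
    unfolding rc_def
    by (rule LeastI_ex[where P = "\<lambda>m. \<exists>c. rainbow_connected G c \<and> card (c ` edges G) = m"])
      (use exists_rainbow_connected[OF assms] in blast)
  ultimately show "\<exists>c. rainbow_connected G c \<and> card (c ` edges G) \<le> k" by auto
next
  assume "\<exists>c. rainbow_connected G c \<and> card (c ` edges G) \<le> k"
  then obtain c where "rainbow_connected G c" "card (c ` edges G) \<le> k" by blast
  moreover have "rc G \<le> card (c ` edges G)" if "rainbow_connected G c" for c
    unfolding rc_def by (rule Least_le) (use that in blast)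
  ultimately show "rc G \<le> k" using order_trans by blast
qed

end

theory Submission
  imports Defs "HOL-Library.FuncSet"
begin

text \<open>
  The proof is the first moment method: among all \<open>k ^ |E|\<close> colorings of the edges with \<open>k\<close> colors,
  fewer than \<open>k ^ |E|\<close> leave some pair of vertices without a rainbow path, so one coloring serves
  every pair. Fix distinct vertices \<open>u\<close> and \<open>v\<close> and put \<open>q = (3k - 2) / k\<^sup>2\<close>.

  \<^item> If \<open>u\<close> and \<open>v\<close> lie in the same class and have \<open>d\<close> common neighbors \<open>w\<close>, the \<open>d\<close> paths
    \<open>u w v\<close> are edge-disjoint and each fails to be rainbow with probability \<open>1 / k \<le> q\<close>.
  \<^item> If they lie in different classes and are non-adjacent, connectedness gives a neighbor \<open>w\<close>
    of \<open>u\<close>. It lies in the class of \<open>v\<close>, so \<open>w\<close> and \<open>v\<close> have \<open>d\<close> common neighbors \<open>z\<close>. The paths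
    \<open>u w z v\<close> share only the edge \<open>uw\<close>; once its color is given, their last two edges are
    colored independently for different \<open>z\<close>, and each path fails to be rainbow with probability
    exactly \<open>1 - (k - 1)(k - 2) / k\<^sup>2 = q\<close>.
  \<^item> If they are adjacent, the edge itself is a rainbow path.

  So a non-adjacent pair fails with probability at most \<open>q ^ d\<close>. The hypothesis says
  \<open>d \<ge> 2 log\<^bsub>1/q\<^esub> n\<close>, that is, \<open>q ^ d \<le> 1 / n\<^sup>2\<close>, and there are only \<open>n (n - 1) < n\<^sup>2\<close> ordered pairs.

  The two probability estimates are \<open>card_bad_colorings_same_class\<close> and
  \<open>card_bad_colorings_nonadjacent\<close>, both instances of the counting lemma \<open>card_PiE_pairs_le\<close>; the
  union bound is \<open>rc_le_of_few_bad_colorings\<close>. To stay within the natural numbers, probabilities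
  are written as counts with denominators cleared.
\<close>

section \<open>Counting colorings with prescribed pairs\<close>

text \<open>
  Independence in counting form. A coloring of \<open>S\<close> is determined by its restriction to the points
  \<open>R\<close> outside the pairs \<open>e i, f i\<close> together with the color pairs on them. Given the restriction
  \<open>r\<close>, each of the \<open>|I|\<close> color pairs has at most \<open>m\<close> instead of \<open>|K|\<^sup>2\<close> possibilities. The set of
  allowed pairs depends on \<open>r\<close> so that conditioning on the color of an edge common to several paths
  is covered.
\<close>
lemma card_PiE_pairs_le:
  fixes e f :: "'i \<Rightarrow> 's" and K :: "'c set" and M :: "('s \<Rightarrow> 'c) \<Rightarrow> ('c \<times> 'c) set"
  assumes S: "finite S" and K: "finite K"
    and e: "inj_on e I" "e ` I \<subseteq> S" and f: "inj_on f I" "f ` I \<subseteq> S"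
    and disj: "e ` I \<inter> f ` I = {}"
    and R: "R = S - e ` I - f ` I"
    and M: "\<And>r. r \<in> R \<rightarrow>\<^sub>E K \<Longrightarrow> M r \<subseteq> K \<times> K \<and> card (M r) \<le> m"
  shows "card {c \<in> S \<rightarrow>\<^sub>E K. \<forall>i\<in>I. (c (e i), c (f i)) \<in> M (restrict c R)}
           * card K ^ (2 * card I) \<le> m ^ card I * card K ^ card S"
proof -
  define X where "X = {c \<in> S \<rightarrow>\<^sub>E K. \<forall>i\<in>I. (c (e i), c (f i)) \<in> M (restrict c R)}"
  define g :: "('s \<Rightarrow> 'c) \<Rightarrow> ('s \<Rightarrow> 'c) \<times> ('i \<Rightarrow> 'c \<times> 'c)"
    where "g c = (restrict c R, \<lambda>i\<in>I. (c (e i), c (f i)))" for c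
  define Y where "Y = Sigma (R \<rightarrow>\<^sub>E K) (\<lambda>r. I \<rightarrow>\<^sub>E M r)"
  have fI: "finite I" using S e by (meson finite_imageD finite_subset)
  have fR: "finite R" using S R by simp
  have fRK: "finite (R \<rightarrow>\<^sub>E K)" using fR K by (simp add: finite_PiE)
  have fM: "finite (M r)" if "r \<in> R \<rightarrow>\<^sub>E K" for r
    using M[OF that] K by (meson finite_SigmaI finite_subset)
  have "inj_on g X"
  proof (rule inj_onI)
    fix c c' assume c: "c \<in> X" "c' \<in> X" and g: "g c = g c'"
    have i: "c (e i) = c' (e i) \<and> c (f i) = c' (f i)" if "i \<in> I" for i
      using arg_cong[OF g, of "\<lambda>p. snd p i"] that by (simp add: g_def)
    have r: "c x = c' x" if "x \<in> R" for x
      using arg_cong[OF g, of "\<lambda>p. fst p x"] that by (simp add: g_def)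
    show "c = c'"
    proof (rule PiE_ext)
      show "c \<in> S \<rightarrow>\<^sub>E K" "c' \<in> S \<rightarrow>\<^sub>E K" using c by (auto simp: X_def)
      show "c x = c' x" if "x \<in> S" for x using i r that R by blast
    qed
  qed
  moreover have "g ` X \<subseteq> Y"
    using R by (auto simp: X_def Y_def g_def restrict_PiE_iff PiE_iff)
  moreover have "finite Y"
    unfolding Y_def by (rule finite_SigmaI[OF fRK]) (simp add: finite_PiE fI fM)
  ultimately have "card X \<le> card Y" by (metis card_inj_on_le)
  also have "card Y = (\<Sum>r\<in>R \<rightarrow>\<^sub>E K. card (I \<rightarrow>\<^sub>E M r))"
    unfolding Y_def by (rule card_SigmaI[OF fRK]) (simp add: finite_PiE fI fM)
  also have "\<dots> \<le> (\<Sum>r\<in>R \<rightarrow>\<^sub>E K. m ^ card I)"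
    using fI M by (intro sum_mono) (simp add: card_PiE power_mono)
  also have "\<dots> = card K ^ card R * m ^ card I" using fR by (simp add: card_PiE)
  finally have X: "card X \<le> card K ^ card R * m ^ card I" .
  have "card (e ` I \<union> f ` I) = 2 * card I"
    using disj fI e f by (simp add: card_Un_disjoint card_image)
  moreover have "card S = card R + card (e ` I \<union> f ` I)"
  proof -
    have "S = R \<union> (e ` I \<union> f ` I)" using R e(2) f(2) by blast
    moreover have "R \<inter> (e ` I \<union> f ` I) = {}" using R by blast
    ultimately show ?thesis using fR fI by (metis card_Un_disjoint finite_UnI finite_imageI)
  qed
  ultimately have "card S = card R + 2 * card I" by simp
  then show ?thesis
    using mult_right_mono[OF X, of "card K ^ (2 * card I)"]
    by (simp add: X_def power_add mult_ac)
qed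

lemma card_equal_pairs: "card {(a, b) \<in> {..<k} \<times> {..<k::nat}. a = b} = k"
proof -
  have "{(a, b) \<in> {..<k} \<times> {..<k::nat}. a = b} = (\<lambda>a. (a, a)) ` {..<k}" by auto
  then show ?thesis by (simp add: card_image inj_on_def)
qed

text \<open>
  For a first edge of color \<open>x\<close>, the color pairs that spoil a path of length three are those with
  \<open>a = x\<close> (\<open>k\<close> pairs), and those with \<open>a \<noteq> x\<close> and \<open>b = x\<close> or \<open>b = a\<close> (\<open>k - 1\<close> pairs each).
\<close>
lemma card_non_rainbow_pairs:
  fixes k x :: nat
  assumes "x < k"
  shows "card {(a, b) \<in> {..<k} \<times> {..<k}. \<not> distinct [x, a, b]} \<le> 3 * k - 2"
proof -
  let ?K = "{..<k}"
  let ?P = "{x} \<times> ?K" and ?Q = "(?K - {x}) \<times> {x}" and ?R = "(\<lambda>a. (a, a)) ` (?K - {x})"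
  have "{(a, b) \<in> ?K \<times> ?K. \<not> distinct [x, a, b]} \<subseteq> ?P \<union> (?Q \<union> ?R)"
    using assms by auto
  then have "card {(a, b) \<in> ?K \<times> ?K. \<not> distinct [x, a, b]} \<le> card (?P \<union> (?Q \<union> ?R))"
    by (intro card_mono) auto
  also have "\<dots> \<le> card ?P + (card ?Q + card ?R)"
    by (meson card_Un_le add_left_mono order_trans)
  also have "\<dots> = k + ((k - 1) + (k - 1))"
    using assms by (simp add: card_cartesian_product card_image inj_on_def)
  also have "\<dots> = 3 * k - 2" using assms by simp
  finally show ?thesis .
qed

section \<open>Rainbow paths of length at most three\<close>

definition rainbow_linked :: "'a pair_pre_digraph \<Rightarrow> ('a set \<Rightarrow> nat) \<Rightarrow> 'a \<Rightarrow> 'a \<Rightarrow> bool" where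
  "rainbow_linked G c u v \<longleftrightarrow>
     (\<exists>p. vpath p (with_proj G) \<and> hd p = u \<and> last p = v \<and> rainbow c p)"

context pair_graph
begin

lemma arc_sym: "(u, v) \<in> parcs G \<Longrightarrow> (v, u) \<in> parcs G"
  using pair_sym_arcs by (auto simp: symmetric_def sym_def)

lemma no_loop: "(v, v) \<notin> parcs G"
  using pair_no_loops[of "(v, v)"] by auto

lemma rainbow_linked_arc:
  assumes "(u, v) \<in> parcs G"
  shows "rainbow_linked G c u v"
proof -
  have "u \<noteq> v" using assms no_loop by auto
  moreover have "u \<in> pverts G" "v \<in> pverts G" using assms by (auto dest: in_arcsD1 in_arcsD2)
  ultimately show ?thesis
    unfolding rainbow_linked_def using assms
    by (intro exI[of _ "[u, v]"]) (auto simp: vpath_def vwalk_def rainbow_def)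
qed

lemma rainbow_linked_two:
  assumes "(u, w) \<in> parcs G" "(w, v) \<in> parcs G" "u \<noteq> v"
    and "c {u, w} \<noteq> c {w, v}"
  shows "rainbow_linked G c u v"
proof -
  have "u \<noteq> w" "w \<noteq> v" using assms no_loop by auto
  moreover have "u \<in> pverts G" "v \<in> pverts G" "w \<in> pverts G"
    using assms by (auto dest: in_arcsD1 in_arcsD2)
  ultimately show ?thesis
    unfolding rainbow_linked_def using assms
    by (intro exI[of _ "[u, w, v]"]) (auto simp: vpath_def vwalk_def rainbow_def)
qed

lemma rainbow_linked_three:
  assumes "(u, w) \<in> parcs G" "(w, z) \<in> parcs G" "(z, v) \<in> parcs G"
    and "distinct [u, w, z, v]"
    and "distinct [c {u, w}, c {w, z}, c {z, v}]"
  shows "rainbow_linked G c u v"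
proof -
  have "u \<in> pverts G" "v \<in> pverts G" "w \<in> pverts G" "z \<in> pverts G"
    using assms by (auto dest: in_arcsD1 in_arcsD2)
  then show ?thesis
    unfolding rainbow_linked_def using assms
    by (intro exI[of _ "[u, w, z, v]"]) (auto simp: vpath_def vwalk_def rainbow_def)
qed

lemma connected_has_neighbor:
  assumes conn: "Digraph_Component.connected (with_proj G)"
    and "u \<in> pverts G" "v \<in> pverts G" "u \<noteq> v"
  shows "\<exists>w. (u, w) \<in> parcs G"
proof -
  have "strongly_connected (with_proj G)"
    by (rule symmetric_connected_imp_strongly_connected[OF _ conn]) (rule sym_arcs)
  then have "reachable (with_proj G) u v"
    using assms unfolding strongly_connected_def by simp
  then show ?thesis using \<open>u \<noteq> v\<close>
    by (cases rule: converse_reachable_cases) auto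
qed

definition bad_colorings :: "nat \<Rightarrow> 'a \<Rightarrow> 'a \<Rightarrow> ('a set \<Rightarrow> nat) set" where
  "bad_colorings k u v = {c \<in> edges G \<rightarrow>\<^sub>E {..<k}. \<not> rainbow_linked G c u v}"

lemma finite_colorings: "finite (edges G \<rightarrow>\<^sub>E {..<k::nat})"
  using finite_edges[OF pair_graph_axioms] by (simp add: finite_PiE)

lemma edgeI: "(u, v) \<in> parcs G \<Longrightarrow> {u, v} \<in> edges G"
  by (auto simp: edges_def)

lemma card_bad_colorings_same_class:
  assumes "u \<noteq> v"
  defines "W \<equiv> neighbors G u \<inter> neighbors G v"
  shows "card (bad_colorings k u v) * k ^ (2 * card W) \<le> k ^ card W * k ^ card (edges G)"
proof -
  let ?K = "{..<k}" and ?E = "edges G"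
  define M where "M = {(a, b) \<in> ?K \<times> ?K. a = b}"
  define e f where "e w = {u, w}" and "f w = {w, v}" for w
  have W: "(u, w) \<in> parcs G" "(w, v) \<in> parcs G" "w \<noteq> u" "w \<noteq> v" if "w \<in> W" for w
    using that arc_sym no_loop by (auto simp: W_def neighbors_def)
  have ef: "e w \<in> ?E" "f w \<in> ?E" if "w \<in> W" for w
    using W[OF that] by (auto simp: e_def f_def intro: edgeI)
  have "bad_colorings k u v \<subseteq> {c \<in> ?E \<rightarrow>\<^sub>E ?K. \<forall>w\<in>W. (c (e w), c (f w)) \<in> M}"
  proof
    fix c assume c: "c \<in> bad_colorings k u v"
    have "(c (e w), c (f w)) \<in> M" if "w \<in> W" for w
    proof -
      have "c (e w) = c (f w)"
        using rainbow_linked_two[OF W(1,2)[OF that] \<open>u \<noteq> v\<close>, of c] c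
        unfolding bad_colorings_def e_def f_def by blast
      moreover have "c (e w) \<in> ?K" "c (f w) \<in> ?K"
        using c ef[OF that] by (auto simp: bad_colorings_def dest: PiE_mem)
      ultimately show ?thesis by (simp add: M_def)
    qed
    then show "c \<in> {c \<in> ?E \<rightarrow>\<^sub>E ?K. \<forall>w\<in>W. (c (e w), c (f w)) \<in> M}"
      using c by (simp add: bad_colorings_def)
  qed
  then have "card (bad_colorings k u v) \<le> card {c \<in> ?E \<rightarrow>\<^sub>E ?K. \<forall>w\<in>W. (c (e w), c (f w)) \<in> M}"
    using finite_colorings by (intro card_mono) auto
  moreover have "card {c \<in> ?E \<rightarrow>\<^sub>E ?K. \<forall>w\<in>W. (c (e w), c (f w)) \<in> M} * card ?K ^ (2 * card W)
      \<le> k ^ card W * card ?K ^ card ?E"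
  proof (rule card_PiE_pairs_le[where M = "\<lambda>_. M"])
    show "inj_on e W" "inj_on f W" using W by (auto simp: inj_on_def e_def f_def doubleton_eq_iff)
    show "e ` W \<inter> f ` W = {}" using W assms by (auto simp: e_def f_def doubleton_eq_iff)
    show "M \<subseteq> ?K \<times> ?K \<and> card M \<le> k" using card_equal_pairs[of k] by (auto simp: M_def)
  qed (use ef finite_edges[OF pair_graph_axioms] in auto)
  ultimately show ?thesis by (simp add: mult_right_mono order_trans[OF mult_right_mono])
qed

text \<open>
  Here \<open>uw\<close> is the common first edge of the paths \<open>u w z v\<close>. Non-adjacency of \<open>u\<close> and \<open>v\<close>
  ensures \<open>z \<noteq> u\<close>, so that these are paths and \<open>uw\<close> is none of the edges \<open>wz\<close>, whose colors must
  be independent of it.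
\<close>
lemma card_bad_colorings_nonadjacent:
  assumes uw: "(u, w) \<in> parcs G" and "u \<noteq> v" "w \<noteq> v" and uv: "(u, v) \<notin> parcs G"
  defines "Z \<equiv> neighbors G w \<inter> neighbors G v"
  shows "card (bad_colorings k u v) * k ^ (2 * card Z) \<le> (3 * k - 2) ^ card Z * k ^ card (edges G)"
proof -
  let ?K = "{..<k}" and ?E = "edges G"
  define M where "M x = {(a, b) \<in> ?K \<times> ?K. \<not> distinct [x, a, b]}" for x
  define e f where "e z = {w, z}" and "f z = {z, v}" for z
  define R where "R = ?E - e ` Z - f ` Z"
  have Z: "(w, z) \<in> parcs G" "(z, v) \<in> parcs G" "z \<noteq> w" "z \<noteq> v" "z \<noteq> u" if "z \<in> Z" for z
    using that uv arc_sym no_loop by (auto simp: Z_def neighbors_def)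
  have "u \<noteq> w" using uw no_loop by auto
  have ef: "e z \<in> ?E" "f z \<in> ?E" if "z \<in> Z" for z
    using Z[OF that] by (auto simp: e_def f_def intro: edgeI)
  have uwR: "{u, w} \<in> R"
    using Z edgeI[OF uw] assms \<open>u \<noteq> w\<close> by (auto simp: R_def e_def f_def doubleton_eq_iff)
  let ?X = "{c \<in> ?E \<rightarrow>\<^sub>E ?K. \<forall>z\<in>Z. (c (e z), c (f z)) \<in> M (restrict c R {u, w})}"
  have "bad_colorings k u v \<subseteq> ?X"
  proof
    fix c assume c: "c \<in> bad_colorings k u v"
    have "(c (e z), c (f z)) \<in> M (c {u, w})" if "z \<in> Z" for z
    proof -
      have "distinct [u, w, z, v]" using Z[OF that] \<open>u \<noteq> w\<close> assms by auto
      then have "\<not> distinct [c {u, w}, c (e z), c (f z)]"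
        using rainbow_linked_three[OF uw Z(1,2)[OF that], of c] c
        unfolding bad_colorings_def e_def f_def by blast
      moreover have "c (e z) \<in> ?K" "c (f z) \<in> ?K"
        using c ef[OF that] by (auto simp: bad_colorings_def dest: PiE_mem)
      ultimately show ?thesis by (simp add: M_def)
    qed
    then show "c \<in> ?X" using c uwR by (simp add: bad_colorings_def)
  qed
  then have "card (bad_colorings k u v) \<le> card ?X"
    using finite_colorings by (intro card_mono) auto
  moreover have "card ?X * card ?K ^ (2 * card Z) \<le> (3 * k - 2) ^ card Z * card ?K ^ card ?E"
  proof (rule card_PiE_pairs_le[where M = "\<lambda>r. M (r {u, w})"])
    show "inj_on e Z" "inj_on f Z" using Z by (auto simp: inj_on_def e_def f_def doubleton_eq_iff)
    show "e ` Z \<inter> f ` Z = {}" using Z assms by (auto simp: e_def f_def doubleton_eq_iff)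
    show "M (r {u, w}) \<subseteq> ?K \<times> ?K \<and> card (M (r {u, w})) \<le> 3 * k - 2" if "r \<in> R \<rightarrow>\<^sub>E ?K" for r
      using card_non_rainbow_pairs[of "r {u, w}" k] PiE_mem[OF that uwR] by (auto simp: M_def)
  qed (use ef finite_edges[OF pair_graph_axioms] in \<open>auto simp: R_def\<close>)
  ultimately show ?thesis by (simp add: order_trans[OF mult_right_mono])
qed

text \<open>
  The union bound. Bad colorings for one pair make up at most a fraction \<open>1 / n\<^sup>2\<close> of all; since
  there are \<open>n\<^sup>2 - n < n\<^sup>2\<close> ordered pairs of distinct vertices, it does no harm to count each
  unordered pair twice.
\<close>
lemma rc_le_of_few_bad_colorings:
  assumes conn: "Digraph_Component.connected (with_proj G)"
    and k: "k \<ge> 1" and ne: "pverts G \<noteq> {}"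
    and few: "\<And>u v. u \<in> pverts G \<Longrightarrow> v \<in> pverts G \<Longrightarrow> u \<noteq> v \<Longrightarrow>
      card (bad_colorings k u v) * card (pverts G) ^ 2 \<le> k ^ card (edges G)"
  shows "rc G \<le> k"
proof -
  let ?V = "pverts G" and ?E = "edges G" and ?C = "edges G \<rightarrow>\<^sub>E {..<k}"
  define n where "n = card ?V"
  have n: "n > 0" using ne by (simp add: n_def card_gt_0_iff)
  let ?P = "?V \<times> ?V - Id_on ?V" and ?N = "k ^ card ?E"
  have "card (Id_on ?V) = n"
  proof -
    have "Id_on ?V = (\<lambda>v. (v, v)) ` ?V" by auto
    then show ?thesis by (simp add: card_image inj_on_def n_def)
  qed
  moreover have "card ?P = card (?V \<times> ?V) - card (Id_on ?V)"
    by (intro card_Diff_subset finite_subset[of "Id_on ?V" "?V \<times> ?V"]) auto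
  ultimately have P: "card ?P = n * n - n" by (simp add: n_def card_cartesian_product)
  have "card (\<Union>(u, v)\<in>?P. bad_colorings k u v) * n\<^sup>2
      \<le> (\<Sum>(u, v)\<in>?P. card (bad_colorings k u v)) * n\<^sup>2"
    by (intro mult_right_mono order_trans[OF card_UN_le]) (auto simp: case_prod_unfold)
  also have "\<dots> = (\<Sum>(u, v)\<in>?P. card (bad_colorings k u v) * n\<^sup>2)"
    by (simp add: sum_distrib_right case_prod_unfold)
  also have "\<dots> \<le> (\<Sum>_\<in>?P. ?N)"
    using few by (intro sum_mono) (auto simp: n_def)
  also have "\<dots> = (n * n - n) * ?N" using P by simp
  also have "\<dots> < n\<^sup>2 * ?N" using n k by (simp add: power2_eq_square)
  finally have "card (\<Union>(u, v)\<in>?P. bad_colorings k u v) < card ?C"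
    using n finite_edges[OF pair_graph_axioms] by (simp add: card_PiE mult.commute)
  moreover have "finite (\<Union>(u, v)\<in>?P. bad_colorings k u v)"
    by (rule finite_subset[OF _ finite_colorings[of k]]) (auto simp: bad_colorings_def)
  ultimately have "\<not> ?C \<subseteq> (\<Union>(u, v)\<in>?P. bad_colorings k u v)"
    by (meson card_mono not_less)
  then obtain c where c: "c \<in> ?C" "c \<notin> (\<Union>(u, v)\<in>?P. bad_colorings k u v)" by blast
  have "rainbow_linked G c u v" if "u \<in> ?V" "v \<in> ?V" "u \<noteq> v" for u v
  proof -
    have "(u, v) \<in> ?P" using that by auto
    then have "c \<notin> bad_colorings k u v" using c(2) by blast
    then show ?thesis using c(1) by (simp add: bad_colorings_def)
  qed
  then have "rainbow_connected G c"
    by (simp add: rainbow_connected_def rainbow_linked_def)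
  moreover have "card (c ` ?E) \<le> k"
    using c(1) card_mono[of "{..<k}" "c ` ?E"] by (auto dest: PiE_mem)
  ultimately show ?thesis using rc_le_iff[OF pair_graph_axioms conn] by blast
qed

end

section \<open>The logarithmic bound\<close>

text \<open>
  With \<open>b = k\<^sup>2 / (3k - 2)\<close>, the product of the two logarithms is \<open>log\<^bsub>b\<^esub> n\<close>, so the hypothesis
  reads \<open>b ^ d \<ge> n\<^sup>2\<close>. This needs \<open>b > 1\<close>, which amounts to \<open>(k - 1)(k - 2) > 0\<close>.
\<close>
lemma log_bound_imp_power_bound:
  fixes k n d :: nat
  assumes k: "k \<ge> 3" and n: "n \<ge> 1"
    and d: "real d \<ge> 2 * log (real k ^ 2 / (3 * real k - 2)) (real k) * log (real k) (real n)"
  shows "(3 * k - 2) ^ d * n\<^sup>2 \<le> k ^ (2 * d)"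
proof -
  define b where "b = real k ^ 2 / (3 * real k - 2)"
  have "0 < (real k - 1) * (real k - 2)" using k by simp
  then have b: "b > 1" using k by (simp add: b_def field_simps power2_eq_square)
  have "log b (real k) * log (real k) (real n) = log b (real n)"
    using k b by (simp add: log_def)
  then have "log b (real n ^ 2) \<le> real d" using d n b by (simp add: b_def log_nat_power mult.assoc)
  then have "real n ^ 2 \<le> b powr real d"
    using b n by (simp add: log_le_iff)
  then have "real n ^ 2 \<le> b ^ d" using b by (simp add: powr_realpow)
  also have "\<dots> = real k ^ (2 * d) / (3 * real k - 2) ^ d"
    by (simp add: b_def power_divide power_mult)
  finally have "(3 * real k - 2) ^ d * real n ^ 2 \<le> real k ^ (2 * d)"
    using k by (simp add: field_simps)
  moreover have "3 * real k - 2 = real (3 * k - 2)" using k by simp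
  ultimately show ?thesis by (metis of_nat_le_iff of_nat_mult of_nat_power)
qed

text \<open>
  Combines a count \<open>x / N \<le> q / z\<close>, the probability of failure, with \<open>q / z \<le> 1 / n\<close>.
\<close>
lemma le_of_scaled_count:
  fixes x y z q N n :: nat
  assumes "x * z \<le> q * N" "q * n \<le> z" "z > 0"
  shows "x * n \<le> N"
proof (cases "q = 0")
  case True
  with assms show ?thesis by simp
next
  case False
  have "q * (x * n) \<le> x * z" using assms(2) by (metis mult.left_commute mult_le_mono2)
  also have "\<dots> \<le> q * N" by fact
  finally show ?thesis using False by simp
qed

theorem theorem1p5:
  fixes k n :: nat and G :: "'a pair_pre_digraph" and A B :: "'a set"
  assumes "k \<ge> 3"
    and "pair_graph G"
    and "Digraph_Component.connected (with_proj G)"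
    and "n = card (pverts G)"
    and "bipartition G A B"
    and "\<not> complete_between G A B"
    and "\<And>u v. u \<in> A \<Longrightarrow> v \<in> A \<Longrightarrow> u \<noteq> v \<Longrightarrow>
      real (card (neighbors G u \<inter> neighbors G v \<inter> B))
        \<ge> 2 * log (real k ^ 2 / (3 * real k - 2)) (real k) * log (real k) (real n)"
    and "\<And>u v. u \<in> B \<Longrightarrow> v \<in> B \<Longrightarrow> u \<noteq> v \<Longrightarrow>
      real (card (neighbors G u \<inter> neighbors G v \<inter> A))
        \<ge> 2 * log (real k ^ 2 / (3 * real k - 2)) (real k) * log (real k) (real n)"
  shows "rc G \<le> k"
proof -
  interpret pair_graph G by (rule assms(2))
  have bip: "A \<union> B = pverts G" "A \<inter> B = {}"
    and arcs: "\<And>u v. (u, v) \<in> parcs G \<Longrightarrow> u \<in> A \<and> v \<in> B \<or> u \<in> B \<and> v \<in> A"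
    using assms(5) by (auto simp: bipartition_def)
  have ne: "pverts G \<noteq> {}" using assms(6) bip by (auto simp: complete_between_def)
  then have n: "n \<ge> 1" using assms(4) by (simp add: Suc_le_eq card_gt_0_iff)
  \<comment> \<open>Arcs join different classes, so all common neighbors of two vertices of one class lie in
    the other one, and intersecting with that class changes nothing.\<close>
  define same where "same u v \<longleftrightarrow> u \<in> A \<and> v \<in> A \<or> u \<in> B \<and> v \<in> B" for u v
  have common: "(3 * k - 2) ^ card (neighbors G u \<inter> neighbors G v) * n\<^sup>2
      \<le> k ^ (2 * card (neighbors G u \<inter> neighbors G v))" if "same u v" "u \<noteq> v" for u v
  proof -
    have "neighbors G u \<inter> neighbors G v = neighbors G u \<inter> neighbors G v \<inter> (if u \<in> A then B else A)"
      using that arcs bip(2) by (auto simp: same_def neighbors_def)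
    then have "real (card (neighbors G u \<inter> neighbors G v))
        \<ge> 2 * log (real k ^ 2 / (3 * real k - 2)) (real k) * log (real k) (real n)"
      using that bip(2) assms(7,8)[of u v] by (auto simp: same_def split: if_splits)
    then show ?thesis by (rule log_bound_imp_power_bound[OF assms(1) n])
  qed
  show ?thesis
  proof (rule rc_le_of_few_bad_colorings[OF assms(3) _ ne])
    fix u v assume uv: "u \<in> pverts G" "v \<in> pverts G" "u \<noteq> v"
    have "card (bad_colorings k u v) * n\<^sup>2 \<le> k ^ card (edges G)"
    proof (cases "same u v")
      case True
      let ?d = "card (neighbors G u \<inter> neighbors G v)"
      have "k ^ ?d \<le> (3 * k - 2) ^ ?d" using assms(1) by (intro power_mono) auto
      then have "card (bad_colorings k u v) * k ^ (2 * ?d) \<le> (3 * k - 2) ^ ?d * k ^ card (edges G)"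
        using card_bad_colorings_same_class[OF uv(3), of k] by (meson mult_right_mono order_trans zero_le)
      then show ?thesis
        by (rule le_of_scaled_count) (use common[OF True uv(3)] assms(1) in auto)
    next
      case False
      show ?thesis
      proof (cases "(u, v) \<in> parcs G")
        case True
        then have "bad_colorings k u v = {}"
          using rainbow_linked_arc by (auto simp: bad_colorings_def)
        then show ?thesis by simp
      next
        case nonadj: False
        obtain w where w: "(u, w) \<in> parcs G"
          using connected_has_neighbor[OF assms(3) uv] by blast
        \<comment> \<open>\<open>v\<close> is in the class other than that of \<open>u\<close>, hence in the class of \<open>w\<close>.\<close>
        then have wv: "w \<noteq> v" "same w v"
          using nonadj False uv arcs[OF w] bip by (auto simp: same_def)
        show ?thesis
          by (rule le_of_scaled_count[OF card_bad_colorings_nonadjacent[OF w uv(3) wv(1) nonadj]])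
            (use common[OF wv(2,1)] assms(1) in auto)
      qed
    qed
    then show "card (bad_colorings k u v) * (card (pverts G))\<^sup>2 \<le> k ^ card (edges G)"
      using assms(4) by simp
  qed (use assms(1) in simp)
qed

end
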